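(* Let $t \ge 2$ be an integer. In the game \textsc{MiMark}-$t$ (\textsc{Mark}-$t$ in misère play), the set of P-positions is exactly $$D'_t = (D_t \setminus \{t^{2k+1} : k \ge 0\}) \cup \{t^{2k} : k \ge 0\},$$ and the set of N-positions is exactly $$V'_t = (V_t \setminus \{t^{2k} : k \ge 0\}) \cup \{t^{2k+1} : k \ge 0\}.$$
   Context: \textsc{Mark}-$t$ is the impartial game whose positions are the nonnegative integers; from a position $n \ge 1$ a move goes to any nonnegative one of $n-1, \ldots, n-(t-1)$, or to $\lfloor n/t \rfloor$; $0$ has no moves. In misère play the player unable to move wins. A P-position is one from which the previous player (the one who just moved) has a winning strategy; an N-position is one from which the next player to move has a winning strategy. $D_t$ (the dopey numbers in base $t$) is the set of positive integers whose base-$t$ representation ends with an odd number of consecutive trailing zeros; $V_t$ (the vile numbers in base $t$) is the set of nonnegative integers not in $D_t$, i.e. those whose base-$t$ representation ends with an even number (possibly zero) of trailing zeros, with $0 \in V_t$. *)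

theory Defs
  imports Main
begin

definition mark_move :: "nat \<Rightarrow> nat \<Rightarrow> nat \<Rightarrow> bool" where
  "mark_move t n m \<longleftrightarrow>
     n \<ge> 1 \<and> ((\<exists>i\<in>{1..t - 1}. i \<le> n \<and> m = n - i) \<or> m = n div t)"

definition terminal :: "nat \<Rightarrow> nat \<Rightarrow> bool" where
  "terminal t n \<longleftrightarrow> (\<nexists>m. mark_move t n m)"

datatype player = Next_Player | Previous_Player

text \<open>A history is the nonempty list of all positions reached so far, starting position
  first.  The next player moves at the starting position, that is, at histories of length 1,
  and the players alternate.\<close>

definition to_move :: "nat list \<Rightarrow> player" where
  "to_move h = (if odd (length h) then Next_Player else Previous_Player)"

text \<open>Every move strictly decreases the position if \<open>t \<ge> 2\<close>, so there are no infinite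
  plays and it suffices to consider finite ones.\<close>

definition complete_play :: "nat \<Rightarrow> nat \<Rightarrow> nat list \<Rightarrow> bool" where
  "complete_play t n ps \<longleftrightarrow>
     ps \<noteq> [] \<and> hd ps = n \<and> successively (mark_move t) ps \<and> terminal t (last ps)"

text \<open>Misere play: the player who is to move at the end of a complete play, and hence is
  unable to move, wins.\<close>

definition misere_winner :: "nat list \<Rightarrow> player" where
  "misere_winner ps = to_move ps"

text \<open>A strategy may depend on the whole history.\<close>

type_synonym strategy = "nat list \<Rightarrow> nat"

definition legal_strategy :: "nat \<Rightarrow> strategy \<Rightarrow> bool" where
  "legal_strategy t \<sigma> \<longleftrightarrow>
     (\<forall>h. h \<noteq> [] \<and> \<not> terminal t (last h) \<longrightarrow> mark_move t (last h) (\<sigma> h))"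

definition follows :: "player \<Rightarrow> strategy \<Rightarrow> nat list \<Rightarrow> bool" where
  "follows pl \<sigma> ps \<longleftrightarrow>
     (\<forall>i. 0 < i \<and> i < length ps \<and> to_move (take i ps) = pl \<longrightarrow> ps ! i = \<sigma> (take i ps))"

definition has_winning_strategy :: "nat \<Rightarrow> nat \<Rightarrow> player \<Rightarrow> bool" where
  "has_winning_strategy t n pl \<longleftrightarrow>
     (\<exists>\<sigma>. legal_strategy t \<sigma> \<and>
        (\<forall>ps. complete_play t n ps \<and> follows pl \<sigma> ps \<longrightarrow> misere_winner ps = pl))"

definition P_positions :: "nat \<Rightarrow> nat set" where
  "P_positions t = {n. has_winning_strategy t n Previous_Player}"

definition N_positions :: "nat \<Rightarrow> nat set" where
  "N_positions t = {n. has_winning_strategy t n Next_Player}"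

text \<open>Base-\<open>t\<close> digits, least significant first and without leading zeros; the test
  \<open>t < 2\<close> only serves to make the function total.\<close>

fun base_digits :: "nat \<Rightarrow> nat \<Rightarrow> nat list" where
  "base_digits t n =
     (if t < 2 \<or> n = 0 then [] else (n mod t) # base_digits t (n div t))"

declare base_digits.simps [simp del]

definition trailing_zeros :: "nat \<Rightarrow> nat \<Rightarrow> nat" where
  "trailing_zeros t n = length (takeWhile (\<lambda>d. d = 0) (base_digits t n))"

definition dopey :: "nat \<Rightarrow> nat set" where
  "dopey t = {n. n > 0 \<and> odd (trailing_zeros t n)}"

definition vile :: "nat \<Rightarrow> nat set" where
  "vile t = - dopey t"

end

theory Submission
  imports Defs
begin

text \<open>Call a set \<open>D\<close> of positions a misere kernel if it consists exactly of the nonterminal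
  positions without a move into \<open>D\<close>. A player who is not to move at a position of \<open>D\<close>, or is to
  move outside \<open>D\<close>, wins by always moving into \<open>D\<close>; since two winning strategies could be played
  against each other, the kernel is the set of P-positions. That \<open>D'\<^sub>t\<close> is the kernel
  reduces to two facts: its only element not divisible by \<open>t\<close> is \<open>1\<close>, and for \<open>m > 0\<close> exactly
  one of \<open>m\<close> and \<open>t * m\<close> lies in \<open>D'\<^sub>t\<close>.\<close>

section \<open>Plays of the game and uniqueness of the winner\<close>

lemma mark_move_less:
  assumes "t \<ge> 2" "mark_move t n m"
  shows "m < n"
  using assms by (auto simp: mark_move_def)

lemma terminal_iff:
  assumes "t \<ge> 2"
  shows "terminal t n \<longleftrightarrow> n = 0"
  using assms by (auto simp: terminal_def mark_move_def)

lemma follows_snoc: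
  "follows pl \<sigma> (ps @ [m]) \<longleftrightarrow>
     follows pl \<sigma> ps \<and> (ps \<noteq> [] \<and> to_move ps = pl \<longrightarrow> m = \<sigma> ps)"
  by (auto simp: follows_def nth_append less_Suc_eq)

text \<open>Extend \<open>h\<close> repeatedly by the choice of whoever is to move; positions
  strictly decrease, so a terminal one is reached. An arbitrary \<open>h\<close> is allowed for the
  sake of this induction.\<close>

lemma ex_play_following_both:
  assumes t: "t \<ge> 2" and legal: "\<And>pl. legal_strategy t (\<sigma> pl)"
  assumes "h \<noteq> []" "successively (mark_move t) h" "\<And>pl. follows pl (\<sigma> pl) h"
  shows "\<exists>ps. complete_play t (hd h) ps \<and> (\<forall>pl. follows pl (\<sigma> pl) ps)"
  using assms(3-5)
proof (induction "last h" arbitrary: h rule: less_induct)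
  case less
  show ?case
  proof (cases "terminal t (last h)")
    case True
    then show ?thesis
      using less.prems unfolding complete_play_def by blast
  next
    case False
    define m where "m = \<sigma> (to_move h) h"
    have move: "mark_move t (last h) m"
      using legal False less.prems(1) unfolding legal_strategy_def m_def by blast
    have "successively (mark_move t) (h @ [m])"
      using move less.prems(1,2) by (simp add: successively_append_iff)
    moreover have "follows pl (\<sigma> pl) (h @ [m])" for pl
      using less.prems(3) by (auto simp: follows_snoc m_def)
    ultimately show ?thesis
      using less.hyps[of "h @ [m]"] mark_move_less[OF t move] less.prems(1) by simp
  qed
qed

lemma not_both_winning:
  assumes t: "t \<ge> 2"
  shows "\<not> (has_winning_strategy t n Next_Player \<and> has_winning_strategy t n Previous_Player)"
proof
  assume "has_winning_strategy t n Next_Player \<and> has_winning_strategy t n Previous_Player"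
  then have "\<forall>pl. has_winning_strategy t n pl"
    by (metis player.exhaust)
  then obtain \<sigma> where \<sigma>: "\<And>pl. legal_strategy t (\<sigma> pl)"
      "\<And>pl ps. complete_play t n ps \<Longrightarrow> follows pl (\<sigma> pl) ps \<Longrightarrow> misere_winner ps = pl"
    unfolding has_winning_strategy_def by metis
  have "follows pl (\<sigma> pl) [n]" for pl
    by (simp add: follows_def)
  then obtain ps where "complete_play t n ps" "\<And>pl. follows pl (\<sigma> pl) ps"
    using ex_play_following_both[of t \<sigma> "[n]", OF t \<sigma>(1)] by auto
  then show False
    using \<sigma>(2) by (metis player.distinct(1))
qed

section \<open>Kernels and winning strategies\<close>

text \<open>Terminal positions are kept out of \<open>D\<close> because in misere play the player to
  move there wins; a normal-play kernel would contain them.\<close>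

definition misere_kernel :: "nat \<Rightarrow> nat set \<Rightarrow> bool" where
  "misere_kernel t D \<longleftrightarrow>
     (\<forall>n. n \<in> D \<longleftrightarrow> \<not> terminal t n \<and> (\<forall>m. mark_move t n m \<longrightarrow> m \<notin> D))"

lemma kernel_strategy:
  assumes K: "misere_kernel t D" and n: "n \<in> D \<longleftrightarrow> pl = Previous_Player"
  shows "has_winning_strategy t n pl"
proof -
  \<comment> \<open>Legality is demanded at every history, so a fallback move is chosen where no
    move leads into \<open>D\<close>.\<close>
  define \<sigma> :: strategy where "\<sigma> h =
    (if \<exists>m. mark_move t (last h) m \<and> m \<in> D
     then SOME m. mark_move t (last h) m \<and> m \<in> D else SOME m. mark_move t (last h) m)" for h
  have into: "mark_move t (last h) (\<sigma> h) \<and> \<sigma> h \<in> D"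
    if "\<exists>m. mark_move t (last h) m \<and> m \<in> D" for h
    using someI_ex[OF that] that by (simp add: \<sigma>_def)
  have any: "mark_move t (last h) (\<sigma> h)" if "\<not> terminal t (last h)" for h
  proof (cases "\<exists>m. mark_move t (last h) m \<and> m \<in> D")
    case True
    then show ?thesis using into by blast
  next
    case False
    have "\<exists>m. mark_move t (last h) m"
      using that by (simp add: terminal_def)
    then have "mark_move t (last h) (SOME m. mark_move t (last h) m)"
      by (rule someI_ex)
    then show ?thesis unfolding \<sigma>_def using False by (simp only: if_False)
  qed
  have invariant: "last ps \<in> D \<longleftrightarrow> to_move ps \<noteq> pl"
    if "ps \<noteq> []" "hd ps = n" "successively (mark_move t) ps" "follows pl \<sigma> ps" for ps
    using that
  proof (induction ps rule: rev_nonempty_induct)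
    case (single x)
    then show ?case using n by (cases pl) (auto simp: to_move_def)
  next
    case (snoc m ps)
    then have move: "mark_move t (last ps) m"
      and IH: "last ps \<in> D \<longleftrightarrow> to_move ps \<noteq> pl"
      and chosen: "to_move ps = pl \<Longrightarrow> m = \<sigma> ps"
      by (auto simp: successively_append_iff follows_snoc)
    have "\<not> terminal t (last ps)"
      using move by (auto simp: terminal_def)
    \<comment> \<open>From \<open>D\<close> no move stays in \<open>D\<close>. Outside
      \<open>D\<close>, the induction hypothesis says that \<open>pl\<close> is to move, and the
      kernel property offers a move into \<open>D\<close>, which \<open>\<sigma>\<close>
      takes.\<close>
    then have "m \<in> D \<longleftrightarrow> last ps \<notin> D"
      using K move IH chosen into[of ps] unfolding misere_kernel_def by metis
    moreover have "to_move (ps @ [m]) \<noteq> pl \<longleftrightarrow> to_move ps = pl"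
      by (cases pl) (auto simp: to_move_def)
    ultimately show ?case using IH by simp
  qed
  \<comment> \<open>The final position is terminal, hence outside \<open>D\<close>, so by the
    invariant \<open>pl\<close> is to move there and wins.\<close>
  have "misere_winner ps = pl" if "complete_play t n ps" "follows pl \<sigma> ps" for ps
    using that invariant[of ps] K
    unfolding complete_play_def misere_winner_def misere_kernel_def by blast
  moreover have "legal_strategy t \<sigma>"
    using any by (simp add: legal_strategy_def)
  ultimately show ?thesis
    unfolding has_winning_strategy_def by blast
qed

lemma positions_of_kernel:
  assumes "t \<ge> 2" "misere_kernel t D"
  shows "P_positions t = D" "N_positions t = - D"
proof -
  have "has_winning_strategy t n Previous_Player \<longleftrightarrow> n \<in> D"
    and "has_winning_strategy t n Next_Player \<longleftrightarrow> n \<notin> D" for n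
    using kernel_strategy[OF assms(2), of n] not_both_winning[OF assms(1), of n]
    by (metis player.distinct(1))+
  then show "P_positions t = D" "N_positions t = - D"
    by (auto simp: P_positions_def N_positions_def)
qed

section \<open>Trailing zeros and the modified dopey numbers\<close>

lemma trailing_zeros_mult:
  assumes "t \<ge> 2" "m > 0"
  shows "trailing_zeros t (t * m) = Suc (trailing_zeros t m)"
  using assms by (subst trailing_zeros_def, subst base_digits.simps) (simp add: trailing_zeros_def)

lemma trailing_zeros_eq_0:
  assumes "\<not> t dvd n"
  shows "trailing_zeros t n = 0"
  using assms by (simp add: trailing_zeros_def base_digits.simps[of t n] dvd_eq_mod_eq_0)

lemma dopey_mult_iff:
  assumes "t \<ge> 2" "m > 0"
  shows "t * m \<in> dopey t \<longleftrightarrow> m \<notin> dopey t"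
  using assms by (simp add: dopey_def trailing_zeros_mult)

lemma dvd_if_dopey: "n \<in> dopey t \<Longrightarrow> t dvd n"
  using trailing_zeros_eq_0 by (force simp: dopey_def)

text \<open>For \<open>t \<ge> 2\<close> the odd powers of \<open>t\<close> are dopey and the even
  ones vile; the two classes swap their powers of \<open>t\<close>.\<close>

definition misere_dopey :: "nat \<Rightarrow> nat set" where
  "misere_dopey t =
     (dopey t - {t ^ (2 * k + 1) | k :: nat. True}) \<union> {t ^ (2 * k) | k :: nat. True}"

lemma even_power_neq_odd_power:
  fixes t :: nat
  assumes "t \<ge> 2"
  shows "t ^ (2 * j) \<noteq> t ^ (2 * k + 1)"
proof
  assume "t ^ (2 * j) = t ^ (2 * k + 1)"
  then have "2 * j = 2 * k + 1"
    using assms by (subst (asm) power_inject_exp) auto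
  then show False by presburger
qed

lemma compl_misere_dopey:
  assumes "t \<ge> 2"
  shows "- misere_dopey t =
    (vile t - {t ^ (2 * k) | k :: nat. True}) \<union> {t ^ (2 * k + 1) | k :: nat. True}"
  using even_power_neq_odd_power[OF assms] unfolding misere_dopey_def vile_def by blast

text \<open>Multiplication by \<open>t\<close> adds one trailing zero, which flips dopeyness, and it
  exchanges even with odd powers of \<open>t\<close>. So it also exchanges the removed and the added
  family.\<close>

lemma mult_in_misere_dopey_iff:
  assumes t: "t \<ge> 2" and m: "m > 0"
  shows "t * m \<in> misere_dopey t \<longleftrightarrow> m \<notin> misere_dopey t"
proof -
  have odd_iff: "(\<exists>k. t * m = t ^ (2 * k + 1)) \<longleftrightarrow> (\<exists>k. m = t ^ (2 * k))"
    using t by simp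
  have even_iff: "(\<exists>k. t * m = t ^ (2 * k)) \<longleftrightarrow> (\<exists>k. m = t ^ (2 * k + 1))"
  proof
    assume "\<exists>k. t * m = t ^ (2 * k)"
    then obtain k where k: "t * m = t ^ (2 * k)" by blast
    \<comment> \<open>\<open>k = 0\<close> would give \<open>t * m = 1\<close>, impossible for
      \<open>t \<ge> 2\<close>.\<close>
    with t obtain j where "k = Suc j" by (cases k) auto
    with k t show "\<exists>k. m = t ^ (2 * k + 1)" by auto
  next
    assume "\<exists>k. m = t ^ (2 * k + 1)"
    then obtain k where "m = t ^ (2 * k + 1)" by blast
    then have "t * m = t ^ (2 * Suc k)" by simp
    then show "\<exists>k. t * m = t ^ (2 * k)" by blast
  qed
  have "\<not> ((\<exists>k. m = t ^ (2 * k)) \<and> (\<exists>k. m = t ^ (2 * k + 1)))"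
    using even_power_neq_odd_power[OF t] by metis
  then show ?thesis
    using odd_iff even_iff dopey_mult_iff[OF t m] unfolding misere_dopey_def by blast
qed

lemma zero_notin_misere_dopey: "t \<ge> 2 \<Longrightarrow> 0 \<notin> misere_dopey t"
  by (auto simp: misere_dopey_def dopey_def)

lemma one_in_misere_dopey: "1 \<in> misere_dopey t"
proof -
  have "1 = t ^ (2 * 0)" by simp
  then show ?thesis unfolding misere_dopey_def by blast
qed

lemma dvd_if_misere_dopey:
  assumes "n \<in> misere_dopey t" "n \<noteq> 1"
  shows "t dvd n"
  using assms dvd_if_dopey by (auto simp: misere_dopey_def dvd_power intro!: dvd_power)

lemma misere_kernel_misere_dopey:
  assumes t: "t \<ge> 2"
  shows "misere_kernel t (misere_dopey t)"
  unfolding misere_kernel_def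
proof
  fix n
  let ?D = "misere_dopey t"
  consider "n = 0" | "n = 1" | m where "m > 0" "n = t * m" | "n > 1" "\<not> t dvd n"
    by (metis dvdE less_one linorder_neqE_nat mult_is_0 neq0_conv)
  then show "n \<in> ?D \<longleftrightarrow> \<not> terminal t n \<and> (\<forall>m. mark_move t n m \<longrightarrow> m \<notin> ?D)"
  proof cases
    case 1
    then show ?thesis using t by (simp add: terminal_iff zero_notin_misere_dopey)
  next
    case 2
    then show ?thesis
      using one_in_misere_dopey zero_notin_misere_dopey[OF t] mark_move_less[OF t, of 1]
      by (auto simp: terminal_iff[OF t])
  next
    case (3 m)
    \<comment> \<open>Exactly one of \<open>n\<close> and \<open>m\<close> lies in
      \<open>?D\<close>. If it is \<open>m\<close>, this move settles the case; if it is
      \<open>n\<close>, the subtraction moves remain to be checked.\<close>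
    have quot: "mark_move t n m"
      using 3 t by (simp add: mark_move_def)
    have "k \<notin> ?D" if n: "n \<in> ?D" and k: "mark_move t n k" for k
    proof -
      have m: "m \<notin> ?D"
        using n 3 mult_in_misere_dopey_iff[OF t] by blast
      show ?thesis
      proof (cases "k = m")
        case False
        moreover have "n div t = m"
          using 3 t by simp
        ultimately obtain i where "i \<in> {1..t - 1}" and i: "i \<le> n" "k = n - i"
          using k unfolding mark_move_def by blast
        then have "0 < i" "i < t"
          by auto
        note i = this i
        \<comment> \<open>Subtracting less than \<open>t\<close> from a multiple of \<open>t\<close>
          leaves a non-multiple, so the only danger is reaching \<open>1\<close>. As
          \<open>m \<ge> 2\<close>, it is out of range.\<close>
        have "m \<noteq> 1"
          using m one_in_misere_dopey by metis
        then have "t * 2 \<le> n"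
          using 3 by simp
        then have "k \<noteq> 1"
          using i by linarith
        moreover have "\<not> t dvd k"
          using i 3 by (metis dvd_diffD1 dvd_triv_left nat_dvd_not_less)
        ultimately show ?thesis
          using dvd_if_misere_dopey by blast
      qed (use m in simp)
    qed
    then show ?thesis
      using quot 3 mult_in_misere_dopey_iff[OF t, of m] t by (auto simp: terminal_iff)
  next
    case 4
    have r: "0 < n mod t" "n mod t < t"
      using 4 t by (auto simp: dvd_eq_mod_eq_0)
    have "\<exists>k. mark_move t n k \<and> k \<in> ?D"
    proof (cases "n < t")
      case True
      \<comment> \<open>Here \<open>n div t = 0\<close>, so the quotient is of no use, but
        \<open>1\<close> is within reach by subtraction.\<close>
      have "mark_move t n 1"
        unfolding mark_move_def using 4 True by (auto intro!: bexI[of _ "n - 1"])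
      then show ?thesis using one_in_misere_dopey by blast
    next
      case False
      \<comment> \<open>Both the quotient and its product with \<open>t\<close>, obtained by
        subtracting \<open>n mod t\<close>, are reachable, and exactly one of them is in
        \<open>?D\<close>.\<close>
      have "mark_move t n (n div t)"
        using 4 by (simp add: mark_move_def)
      moreover have "mark_move t n (t * (n div t))"
        unfolding mark_move_def using 4 r
        by (auto intro!: bexI[of _ "n mod t"] simp: minus_mod_eq_mult_div)
      moreover have "n div t > 0"
        using False t by (simp add: div_greater_zero_iff)
      ultimately show ?thesis
        using mult_in_misere_dopey_iff[OF t] by blast
    qed
    moreover have "n \<notin> ?D"
      using 4 dvd_if_misere_dopey by blast
    ultimately show ?thesis by blast
  qed
qed

theorem theorem5:
  fixes t :: nat
  assumes "t \<ge> 2"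
  shows "P_positions t =
           (dopey t - {t ^ (2 * k + 1) | k :: nat. True}) \<union> {t ^ (2 * k) | k :: nat. True} \<and>
         N_positions t =
           (vile t - {t ^ (2 * k) | k :: nat. True}) \<union> {t ^ (2 * k + 1) | k :: nat. True}"
  using positions_of_kernel[OF assms misere_kernel_misere_dopey[OF assms]]
  unfolding compl_misere_dopey[OF assms] by (simp add: misere_dopey_def)

end
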